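(* Let $\mathscr{H}$ be a real Hilbert space, let $\mathcal{F}:\mathscr{H}\to\mathscr{H}$ be firmly nonexpansive, and let $\{\bm{\psi}^k\}_{k\ge 0}$ be fixed-point iterates, $\bm{\psi}^{k+1}=\mathcal{F}\bm{\psi}^k$, that converge to $\bm{\psi}^\star\in\mathrm{Fix}(\mathcal{F})$. Then for every integer $k\ge 0$, $$\|\bm{\psi}^{k+1}-\bm{\psi}^k\|^2\le\frac{1}{k+1}\|\bm{\psi}^\star-\bm{\psi}^0\|^2.$$ Furthermore, if $\mathcal{F}$ is $1/L$-cocoercive with $L\in(0,1)$, then for every integer $k\ge 0$, $$\|\bm{\psi}^{k+1}-\bm{\psi}^k\|^2\le\Big(\frac{L}{2-L}\Big)^k\cdot\frac{1-\frac{L}{2-L}}{1-\big(\frac{L}{2-L}\big)^{k+1}}\,\|\bm{\psi}^\star-\bm{\psi}^0\|^2.$$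
   Context: An operator $\mathcal{T}:\mathscr{H}\to\mathscr{H}$ is $1/L$-cocoercive ($L>0$) if $\frac1L\|\mathcal{T}\bm{x}-\mathcal{T}\bm{y}\|^2\le\langle\mathcal{T}\bm{x}-\mathcal{T}\bm{y},\bm{x}-\bm{y}\rangle$ for all $\bm{x},\bm{y}\in\mathscr{H}$, and firmly nonexpansive if it is $1$-cocoercive. $\mathrm{Fix}(\mathcal{F})=\{\bm{\psi}:\mathcal{F}\bm{\psi}=\bm{\psi}\}$. *)

theory Defs
  imports "HOL-Analysis.Analysis"
begin

(* The parameter is the cocoercivity constant itself: an operator that is 1/L-cocoercive
   satisfies cocoercive (1 / L); the condition L > 0 is the conjunct 0 < c. *)
definition cocoercive :: "real \<Rightarrow> ('a::real_inner \<Rightarrow> 'a) \<Rightarrow> bool" where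
  "cocoercive c T \<longleftrightarrow>
     0 < c \<and> (\<forall>x y. c * (norm (T x - T y))\<^sup>2 \<le> inner (T x - T y) (x - y))"

definition firmly_nonexpansive :: "('a::real_inner \<Rightarrow> 'a) \<Rightarrow> bool" where
  "firmly_nonexpansive T \<longleftrightarrow> cocoercive 1 T"

definition Fix :: "('a \<Rightarrow> 'a) \<Rightarrow> 'a set" where
  "Fix F = {\<psi>. F \<psi> = \<psi>}"

end

theory Submission
  imports Defs
begin

text \<open>
  With \<open>r = L / (2 - L)\<close>, \<open>1 / L\<close>-cocoercivity says
  \<open>\<parallel>F x - F y\<parallel>\<^sup>2 \<le> r (\<parallel>x - y\<parallel>\<^sup>2 - \<parallel>(x - y) - (F x - F y)\<parallel>\<^sup>2)\<close>. Put \<open>a\<^sub>k = \<parallel>\<psi>\<^sub>k - \<psi>\<^sup>\<star>\<parallel>\<^sup>2\<close> and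
  \<open>D\<^sub>k = \<parallel>\<psi>\<^sub>k\<^sub>+\<^sub>1 - \<psi>\<^sub>k\<parallel>\<^sup>2\<close>. Then \<open>a\<^sub>k\<^sub>+\<^sub>1 \<le> r (a\<^sub>k - D\<^sub>k)\<close> and \<open>D\<^sub>k\<^sub>+\<^sub>1 \<le> r D\<^sub>k\<close>, so the energy
  \<open>a\<^sub>k + k D\<^sub>k\<close> shrinks by the factor \<open>r\<close> in each step. As \<open>D\<^sub>k \<le> a\<^sub>k\<close>, this gives
  \<open>(k + 1) D\<^sub>k \<le> r\<^sup>k a\<^sub>0\<close>. For \<open>r = 1\<close> this is the first claim; for \<open>r < 1\<close> it is even stronger than
  the second, because \<open>(1 - r\<^sup>k\<^sup>+\<^sup>1) / (1 - r) = 1 + r + \<dots> + r\<^sup>k \<le> k + 1\<close>.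
\<close>

lemma cocoercive_norm_bound:
  assumes "0 < L" "L < 2" "cocoercive (1 / L) F"
  shows "(norm (F x - F y))\<^sup>2 \<le>
    L / (2 - L) * ((norm (x - y))\<^sup>2 - (norm ((x - y) - (F x - F y)))\<^sup>2)"
proof -
  define d e where "d = x - y" and "e = F x - F y"
  have "1 / L * (norm e)\<^sup>2 \<le> inner e d"
    using assms(3) by (simp add: cocoercive_def d_def e_def)
  hence "(norm e)\<^sup>2 \<le> L * inner e d"
    using assms(1) by (simp add: field_simps)
  moreover have "(norm d)\<^sup>2 - (norm (d - e))\<^sup>2 = 2 * inner e d - (norm e)\<^sup>2"
    by (simp add: power2_norm_eq_inner inner_diff inner_commute)
  hence "L * ((norm d)\<^sup>2 - (norm (d - e))\<^sup>2) = 2 * (L * inner e d) - L * (norm e)\<^sup>2"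
    by (simp add: right_diff_distrib)
  ultimately have "(2 - L) * (norm e)\<^sup>2 \<le> L * ((norm d)\<^sup>2 - (norm (d - e))\<^sup>2)"
    by (simp add: left_diff_distrib)
  thus ?thesis
    using assms(2) unfolding d_def[symmetric] e_def[symmetric] by (simp add: field_simps)
qed

lemma cocoercive_residual_bound:
  assumes L: "0 < L" "L < 2" "cocoercive (1 / L) F"
    and step: "\<And>k. \<psi> (Suc k) = F (\<psi> k)"
    and fix_pt: "\<psi>star \<in> Fix F"
  shows "(real k + 1) * (norm (\<psi> (Suc k) - \<psi> k))\<^sup>2 \<le>
    (L / (2 - L)) ^ k * (norm (\<psi>star - \<psi> 0))\<^sup>2"
proof -
  define r where "r = L / (2 - L)"
  define a where "a k = (norm (\<psi> k - \<psi>star))\<^sup>2" for k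
  define D where "D k = (norm (\<psi> (Suc k) - \<psi> k))\<^sup>2" for k
  have r: "0 < r" using L by (simp add: r_def)
  note bound = cocoercive_norm_bound[OF L, folded r_def]
  \<comment> \<open>As \<open>\<psi>star\<close> is fixed, the subtracted vector in
    \<open>bound\<close> is \<open>\<psi> k - \<psi> (Suc k)\<close>.\<close>
  have a_step: "a (Suc k) \<le> r * (a k - D k)" for k
    using bound[of "\<psi> k" \<psi>star] fix_pt
    by (simp add: a_def D_def step Fix_def norm_minus_commute)
  have D_step: "D (Suc k) \<le> r * D k" for k
  proof -
    have "D (Suc k) \<le>
        r * (D k - (norm ((\<psi> (Suc k) - \<psi> k) - (F (\<psi> (Suc k)) - F (\<psi> k))))\<^sup>2)"
      using bound[of "\<psi> (Suc k)" "\<psi> k"] by (simp add: D_def step)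
    also have "\<dots> \<le> r * D k"
      using r by (intro mult_left_mono) auto
    finally show ?thesis .
  qed
  have energy: "a k + real k * D k \<le> r ^ k * a 0"
  proof (induction k)
    case (Suc k)
    have "a (Suc k) + real (Suc k) * D (Suc k) \<le> r * (a k - D k) + real (Suc k) * (r * D k)"
      using a_step D_step by (intro add_mono mult_left_mono) auto
    \<comment> \<open>The \<open>- D k\<close> from \<open>a_step\<close> cancels one of the
      \<open>Suc k\<close> copies of \<open>D k\<close>.\<close>
    also have "\<dots> = r * (a k + real k * D k)"
      by (simp add: algebra_simps)
    also have "\<dots> \<le> r * (r ^ k * a 0)"
      using Suc r by (intro mult_left_mono) auto
    finally show ?case by (simp add: mult.assoc)
  qed simp
  \<comment> \<open>Squared distances are nonnegative, in particular
    \<open>a (Suc k)\<close>.\<close>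
  have "0 \<le> r * (a k - D k)"
    using a_step[of k] by (rule order_trans[rotated]) (simp add: a_def)
  hence "D k \<le> a k"
    using r by (simp add: zero_le_mult_iff)
  with energy have "(real k + 1) * D k \<le> r ^ k * a 0"
    by (simp add: algebra_simps)
  thus ?thesis
    by (simp add: a_def D_def r_def norm_minus_commute)
qed

lemma inverse_le_geometric_ratio:
  fixes r :: real
  assumes "0 < r" "r < 1"
  shows "1 / (real k + 1) \<le> (1 - r) / (1 - r ^ (k + 1))"
proof -
  have "(1 - r ^ (k + 1)) = (1 - r) * (\<Sum>i\<le>k. r ^ i)"
    using assms by (simp add: sum_gp0)
  also have "\<dots> \<le> (1 - r) * (\<Sum>i\<le>k. 1)"
    using assms by (intro mult_left_mono sum_mono) (auto intro: power_le_one)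
  finally have "1 - r ^ (k + 1) \<le> (1 - r) * (real k + 1)"
    by (simp add: add.commute)
  \<comment> \<open>Strictness makes the denominator positive, which permits the division.\<close>
  moreover have "r ^ (k + 1) < 1"
    using assms power_Suc_less_one[of r k] by simp
  ultimately show ?thesis
    by (simp add: field_simps)
qed

theorem proposition4p1:
  fixes F :: "'a::{real_inner, complete_space} \<Rightarrow> 'a"
    and \<psi> :: "nat \<Rightarrow> 'a"
    and \<psi>star :: 'a
  assumes "firmly_nonexpansive F"
    and "\<And>k. \<psi> (Suc k) = F (\<psi> k)"
    and "\<psi>star \<in> Fix F"
    and "\<psi> \<longlonglongrightarrow> \<psi>star"
  shows "(\<forall>k. (norm (\<psi> (Suc k) - \<psi> k))\<^sup>2 \<le> 1 / (real k + 1) * (norm (\<psi>star - \<psi> 0))\<^sup>2) \<and>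
    (\<forall>L::real. 0 < L \<and> L < 1 \<and> cocoercive (1 / L) F \<longrightarrow>
      (\<forall>k. (norm (\<psi> (Suc k) - \<psi> k))\<^sup>2 \<le>
        (L / (2 - L)) ^ k * ((1 - L / (2 - L)) / (1 - (L / (2 - L)) ^ (k + 1))) *
          (norm (\<psi>star - \<psi> 0))\<^sup>2))"
proof (intro conjI allI impI)
  fix k
  \<comment> \<open>At \<open>L = 1\<close> the ratio \<open>L / (2 - L)\<close> is 1.\<close>
  have "(real k + 1) * (norm (\<psi> (Suc k) - \<psi> k))\<^sup>2 \<le> (norm (\<psi>star - \<psi> 0))\<^sup>2"
    using cocoercive_residual_bound[of 1 F \<psi> \<psi>star k] assms(1-3)
    by (simp add: firmly_nonexpansive_def)
  thus "(norm (\<psi> (Suc k) - \<psi> k))\<^sup>2 \<le> 1 / (real k + 1) * (norm (\<psi>star - \<psi> 0))\<^sup>2"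
    by (simp add: field_simps)
next
  fix L :: real and k
  assume L: "0 < L \<and> L < 1 \<and> cocoercive (1 / L) F"
  define r where "r = L / (2 - L)"
  have r: "0 < r" "r < 1"
    using L by (auto simp: r_def)
  have "(real k + 1) * (norm (\<psi> (Suc k) - \<psi> k))\<^sup>2 \<le> r ^ k * (norm (\<psi>star - \<psi> 0))\<^sup>2"
    using cocoercive_residual_bound[of L F \<psi> \<psi>star k] L assms(2,3) by (simp add: r_def)
  hence "(norm (\<psi> (Suc k) - \<psi> k))\<^sup>2 \<le> r ^ k * (1 / (real k + 1)) * (norm (\<psi>star - \<psi> 0))\<^sup>2"
    by (simp add: field_simps)
  also have "\<dots> \<le> r ^ k * ((1 - r) / (1 - r ^ (k + 1))) * (norm (\<psi>star - \<psi> 0))\<^sup>2"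
    using r by (intro mult_right_mono mult_left_mono inverse_le_geometric_ratio) auto
  finally show "(norm (\<psi> (Suc k) - \<psi> k))\<^sup>2 \<le>
      (L / (2 - L)) ^ k * ((1 - L / (2 - L)) / (1 - (L / (2 - L)) ^ (k + 1))) *
        (norm (\<psi>star - \<psi> 0))\<^sup>2"
    by (simp only: r_def)
qed

end
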